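(* Let $p$ be an odd prime, let $G$ be a finite $p$-group of nilpotency class $2$, and let $w$ be a word in $k$ variables. Then $N_w(g) \geq |G|^{k-2}$ for all $g \in G_w$.
   Context: A word $w$ in $k$ variables $x_1,\ldots,x_k$ ($k\ge 1$) is an element of the free group $F_k$ on $x_1,\ldots,x_k$. For elements $g_1,\ldots,g_k$ of a group $G$, $w(g_1,\ldots,g_k)\in G$ denotes the image of $w$ under the homomorphism $F_k\to G$ sending $x_i\mapsto g_i$ for $1\le i\le k$. Write $G^{(k)}$ for the direct product of $k$ copies of $G$. The set of $w$-values is $G_w=\{w(g_1,\ldots,g_k) : (g_1,\ldots,g_k)\in G^{(k)}\}$. For a finite group $G$ and $g\in G$, $N_w(g)=N_{w,G}(g)=|\{(g_1,\ldots,g_k)\in G^{(k)} : w(g_1,\ldots,g_k)=g\}|$. The inequality is one of rational numbers (for $k=1$ the right-hand side is $|G|^{-1}$). *)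

theory Defs
  imports "HOL-Algebra.Algebra" "HOL-Computational_Algebra.Primes"
begin

section \<open>The free group on \<open>x\<^sub>1, \<dots>, x\<^sub>k\<close>\<close>

text \<open>
  The letter \<open>(i, True)\<close> stands for \<open>x\<^sub>i\<close> and \<open>(i, False)\<close> for its inverse. The free group is
  realised on the reduced words, with concatenation followed by free reduction as multiplication.
\<close>

type_synonym letter = "nat \<times> bool"

definition flip :: "letter \<Rightarrow> letter"
  where "flip a = (fst a, \<not> snd a)"

definition freely_reduced :: "letter list \<Rightarrow> bool"
  where "freely_reduced w \<longleftrightarrow> successively (\<lambda>a b. b \<noteq> flip a) w"

fun push :: "letter \<Rightarrow> letter list \<Rightarrow> letter list" where
  "push a [] = [a]"
| "push a (b # w) = (if b = flip a then w else a # b # w)"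

definition free_group :: "nat \<Rightarrow> letter list monoid"
  where "free_group k =
    \<lparr>carrier = {w. freely_reduced w \<and> fst ` set w \<subseteq> {1..k}},
     monoid.mult = (\<lambda>u v. foldr push u v),
     one = []\<rparr>"

definition free_gen :: "nat \<Rightarrow> letter list"
  where "free_gen i = [(i, True)]"

lemma flip_flip [simp]: "flip (flip a) = a"
  by (simp add: flip_def)

lemma fst_flip [simp]: "fst (flip a) = fst a"
  by (simp add: flip_def)

lemma flip_neq [simp]: "flip a \<noteq> a" "a \<noteq> flip a"
  by (auto simp: flip_def prod_eq_iff)

lemma flip_eq_iff: "flip a = b \<longleftrightarrow> a = flip b"
  by auto

lemma freely_reduced_Nil [simp]: "freely_reduced []"
  by (simp add: freely_reduced_def)

lemma freely_reduced_tl: "freely_reduced (a # w) \<Longrightarrow> freely_reduced w"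
  by (auto simp: freely_reduced_def successively_Cons)

lemma freely_reduced_push: "freely_reduced w \<Longrightarrow> freely_reduced (push a w)"
  by (cases w) (auto simp: freely_reduced_def successively_Cons)

lemma push_reduced: "freely_reduced (a # w) \<Longrightarrow> push a w = a # w"
  by (cases w) (auto simp: freely_reduced_def)

lemma set_push: "set (push a w) \<subseteq> insert a (set w)"
  by (cases w) auto

lemma push_flip_push: "freely_reduced w \<Longrightarrow> push a (push (flip a) w) = w"
  by (cases w) (auto simp: push_reduced flip_eq_iff)

lemma freely_reduced_foldr_push: "freely_reduced v \<Longrightarrow> freely_reduced (foldr push u v)"
  by (induction u) (auto simp: freely_reduced_push)

lemma set_foldr_push: "set (foldr push u v) \<subseteq> set u \<union> set v"
proof (induction u)
  case (Cons a u)
  then show ?case using set_push[of a "foldr push u v"] by auto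
qed simp

lemma foldr_push_push:
  assumes "freely_reduced w"
  shows "foldr push (push a v) w = push a (foldr push v w)"
proof (cases v)
  case (Cons b v')
  have "push a (push (flip a) (foldr push v' w)) = foldr push v' w"
    by (intro push_flip_push freely_reduced_foldr_push assms)
  then show ?thesis using Cons by auto
qed simp

lemma foldr_push_assoc:
  assumes "freely_reduced w"
  shows "foldr push (foldr push u v) w = foldr push u (foldr push v w)"
  by (induction u) (simp_all add: foldr_push_push assms)

lemma foldr_push_inverse: "foldr push (rev (map flip w)) w = []"
  by (induction w) auto

lemma freely_reduced_inverse: "freely_reduced w \<Longrightarrow> freely_reduced (rev (map flip w))"
  unfolding freely_reduced_def by (auto simp: successively_map flip_eq_iff elim: successively_mono)

lemma group_free_group: "group (free_group k)"
proof (rule groupI)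
  fix u v assume "u \<in> carrier (free_group k)" "v \<in> carrier (free_group k)"
  then show "u \<otimes>\<^bsub>free_group k\<^esub> v \<in> carrier (free_group k)"
    using set_foldr_push[of u v] by (force simp: free_group_def freely_reduced_foldr_push)
next
  fix u v w
  assume "u \<in> carrier (free_group k)" "v \<in> carrier (free_group k)" "w \<in> carrier (free_group k)"
  then show "u \<otimes>\<^bsub>free_group k\<^esub> v \<otimes>\<^bsub>free_group k\<^esub> w = u \<otimes>\<^bsub>free_group k\<^esub> (v \<otimes>\<^bsub>free_group k\<^esub> w)"
    by (simp add: free_group_def foldr_push_assoc)
next
  fix w assume "w \<in> carrier (free_group k)"
  then have "rev (map flip w) \<in> carrier (free_group k)"
    and "rev (map flip w) \<otimes>\<^bsub>free_group k\<^esub> w = \<one>\<^bsub>free_group k\<^esub>"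
    by (auto simp: free_group_def freely_reduced_inverse foldr_push_inverse)
  then show "\<exists>v\<in>carrier (free_group k). v \<otimes>\<^bsub>free_group k\<^esub> w = \<one>\<^bsub>free_group k\<^esub>" by blast
qed (auto simp: free_group_def)


section \<open>Word maps\<close>

definition letter_value :: "('a, 'b) monoid_scheme \<Rightarrow> (nat \<Rightarrow> 'a) \<Rightarrow> letter \<Rightarrow> 'a"
  where "letter_value G g a = (if snd a then g (fst a) else inv\<^bsub>G\<^esub> g (fst a))"

text \<open>
  \<open>word_value G g w\<close> is \<open>w(g\<^sub>1, \<dots>, g\<^sub>k)\<close>; the three lemmas \<open>word_value_hom\<close>,
  \<open>word_value_free_gen\<close> and \<open>word_value_unique\<close> below show that it is the image of \<open>w\<close> under the
  unique homomorphism from the free group to \<open>G\<close> that sends each \<open>x\<^sub>i\<close> to \<open>g\<^sub>i\<close>.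
\<close>

definition word_value :: "('a, 'b) monoid_scheme \<Rightarrow> (nat \<Rightarrow> 'a) \<Rightarrow> letter list \<Rightarrow> 'a"
  where "word_value G g w = foldr (\<lambda>a y. letter_value G g a \<otimes>\<^bsub>G\<^esub> y) w \<one>\<^bsub>G\<^esub>"

lemma word_value_Nil [simp]: "word_value G g [] = \<one>\<^bsub>G\<^esub>"
  by (simp add: word_value_def)

lemma word_value_Cons [simp]:
  "word_value G g (a # w) = letter_value G g a \<otimes>\<^bsub>G\<^esub> word_value G g w"
  by (simp add: word_value_def)

context group
begin

lemma letter_value_closed:
  "\<lbrakk>g \<in> {1..k} \<rightarrow> carrier G; fst a \<in> {1..k}\<rbrakk> \<Longrightarrow> letter_value G g a \<in> carrier G"
  unfolding letter_value_def by (metis Pi_mem inv_closed)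

lemma letter_value_flip:
  "\<lbrakk>g \<in> {1..k} \<rightarrow> carrier G; fst a \<in> {1..k}\<rbrakk> \<Longrightarrow> letter_value G g (flip a) = inv (letter_value G g a)"
  unfolding letter_value_def flip_def by (simp add: Pi_iff)

lemma word_value_closed:
  assumes "g \<in> {1..k} \<rightarrow> carrier G" "fst ` set w \<subseteq> {1..k}"
  shows "word_value G g w \<in> carrier G"
  using assms(2) by (induction w) (auto intro!: m_closed letter_value_closed[OF assms(1)])

lemma word_value_push:
  assumes g: "g \<in> {1..k} \<rightarrow> carrier G" and a: "fst a \<in> {1..k}" and w: "fst ` set w \<subseteq> {1..k}"
  shows "word_value G g (push a w) = letter_value G g a \<otimes> word_value G g w"
proof (cases w)
  case (Cons b w')
  have "word_value G g w' \<in> carrier G"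
    using w Cons by (intro word_value_closed[OF g]) auto
  then show ?thesis
    using Cons letter_value_closed[OF g a] by (simp add: letter_value_flip[OF g a] m_assoc[symmetric])
qed simp

lemma word_value_foldr_push:
  assumes g: "g \<in> {1..k} \<rightarrow> carrier G" and "fst ` set u \<subseteq> {1..k}" and v: "fst ` set v \<subseteq> {1..k}"
  shows "word_value G g (foldr push u v) = word_value G g u \<otimes> word_value G g v"
  using assms(2)
proof (induction u)
  case Nil
  then show ?case using word_value_closed[OF g v] by simp
next
  case (Cons a u)
  then have a: "fst a \<in> {1..k}" and u: "fst ` set u \<subseteq> {1..k}" by auto
  have "fst ` set (foldr push u v) \<subseteq> {1..k}"
    using set_foldr_push[of u v] u v by blast
  then show ?case
    using Cons.IH[OF u] letter_value_closed[OF g a] word_value_closed[OF g u] word_value_closed[OF g v]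
    by (simp add: word_value_push[OF g a] m_assoc)
qed

lemma word_value_hom:
  assumes "g \<in> {1..k} \<rightarrow> carrier G"
  shows "word_value G g \<in> hom (free_group k) G"
  by (rule homI) (simp_all add: free_group_def word_value_closed[OF assms] word_value_foldr_push[OF assms])

lemma word_value_free_gen:
  assumes "g \<in> {1..k} \<rightarrow> carrier G" "i \<in> {1..k}"
  shows "free_gen i \<in> carrier (free_group k)" "word_value G g (free_gen i) = g i"
  using assms Pi_mem[OF assms]
  by (simp_all add: free_gen_def free_group_def freely_reduced_def letter_value_def)

lemma word_value_unique:
  assumes g: "g \<in> {1..k} \<rightarrow> carrier G" and h: "h \<in> hom (free_group k) G"
    and gen: "\<And>i. i \<in> {1..k} \<Longrightarrow> h (free_gen i) = g i"
    and w: "w \<in> carrier (free_group k)"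
  shows "h w = word_value G g w"
proof -
  interpret h: group_hom "free_group k" G h
    using h by (simp add: group_hom_def group_hom_axioms_def group_free_group is_group)
  have letter: "h [a] = letter_value G g a" if "fst a \<in> {1..k}" for a
  proof (cases a)
    case (Pair i b)
    have pos: "[(i, True)] \<in> carrier (free_group k)"
      and neg: "[(i, False)] \<in> carrier (free_group k)"
      using that Pair by (auto simp: free_group_def freely_reduced_def)
    have "[(i, False)] \<otimes>\<^bsub>free_group k\<^esub> [(i, True)] = \<one>\<^bsub>free_group k\<^esub>"
      by (simp add: free_group_def flip_def)
    then have "[(i, False)] = inv\<^bsub>free_group k\<^esub> [(i, True)]"
      using group.inv_equality[OF group_free_group _ pos neg] by metis
    then show ?thesis
      using gen[of i] that Pair pos by (cases b) (auto simp: letter_value_def free_gen_def)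
  qed
  show ?thesis using w
  proof (induction w)
    case Nil
    then show ?case using h.hom_one by (simp add: free_group_def)
  next
    case (Cons a w)
    then have a: "fst a \<in> {1..k}" and w: "w \<in> carrier (free_group k)"
      and aw: "freely_reduced (a # w)" by (auto simp: free_group_def dest: freely_reduced_tl)
    have "[a] \<in> carrier (free_group k)" using a by (auto simp: free_group_def freely_reduced_def)
    moreover have "a # w = [a] \<otimes>\<^bsub>free_group k\<^esub> w"
      using push_reduced[OF aw] by (simp add: free_group_def)
    ultimately have "h (a # w) = h [a] \<otimes> h w" using h.hom_mult w by metis
    then show ?case using letter[OF a] Cons.IH[OF w] by simp
  qed
qed

end

definition tuples :: "('a, 'b) monoid_scheme \<Rightarrow> nat \<Rightarrow> (nat \<Rightarrow> 'a) monoid"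
  where "tuples G k = product_group {1..k} (\<lambda>_. G)"

definition word_values :: "('a, 'b) monoid_scheme \<Rightarrow> nat \<Rightarrow> letter list \<Rightarrow> 'a set"
  where "word_values G k w = {word_value G g w | g. g \<in> carrier (tuples G k)}"

definition num_solutions :: "('a, 'b) monoid_scheme \<Rightarrow> nat \<Rightarrow> letter list \<Rightarrow> 'a \<Rightarrow> nat"
  where "num_solutions G k w x = card {g \<in> carrier (tuples G k). word_value G g w = x}"


section \<open>Finite \<open>p\<close>-groups and nilpotency class\<close>

definition finite_p_group :: "nat \<Rightarrow> ('a, 'b) monoid_scheme \<Rightarrow> bool"
  where "finite_p_group p G \<longleftrightarrow> group G \<and> finite (carrier G) \<and> (\<exists>n. order G = p ^ n)"

definition commutator_subgroup :: "('a, 'b) monoid_scheme \<Rightarrow> 'a set \<Rightarrow> 'a set \<Rightarrow> 'a set"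
  where "commutator_subgroup G H K =
    generate G {inv\<^bsub>G\<^esub> x \<otimes>\<^bsub>G\<^esub> inv\<^bsub>G\<^esub> y \<otimes>\<^bsub>G\<^esub> x \<otimes>\<^bsub>G\<^esub> y | x y. x \<in> H \<and> y \<in> K}"

text \<open>Indexing starts at \<open>0\<close>: \<open>lower_central G n\<close> is the term usually written \<open>\<gamma>\<^sub>n\<^sub>+\<^sub>1(G)\<close>.\<close>

primrec lower_central :: "('a, 'b) monoid_scheme \<Rightarrow> nat \<Rightarrow> 'a set" where
  "lower_central G 0 = carrier G"
| "lower_central G (Suc n) = commutator_subgroup G (lower_central G n) (carrier G)"

definition has_nilpotency_class :: "('a, 'b) monoid_scheme \<Rightarrow> nat \<Rightarrow> bool"
  where "has_nilpotency_class G c \<longleftrightarrow>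
    lower_central G c = {\<one>\<^bsub>G\<^esub>} \<and> (\<forall>d<c. lower_central G d \<noteq> {\<one>\<^bsub>G\<^esub>})"

end

theory Submission
  imports Defs
begin

text \<open>
  Since \<open>G\<close> has odd order and class \<open>2\<close>, the Baer correspondence turns it into an abelian group with an
  alternating bilinear pairing \<open>\<beta>\<close>, in which a word becomes a quadratic map
  \<open>\<Sum>\<^sub>i a\<^sub>i x\<^sub>i + \<Sum>\<^sub>i\<^sub>j c\<^sub>i\<^sub>j \<beta>(x\<^sub>i, x\<^sub>j)\<close> with an antisymmetric integer matrix \<open>c\<close>. Integral substitutions of
  the variables permute the tuples and bring \<open>c\<close> to a form in which the variables split into two
  classes with no interaction inside a class. Then the map is affine in each class while the other
  one is fixed. Starting from one solution, varying the first class gives at least \<open>|G|\<^sup>s\<^sup>-\<^sup>1\<close>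
  solutions, where \<open>s\<close> is its size, and from each of these varying the second class gives at
  least \<open>|G|\<^sup>k\<^sup>-\<^sup>s\<^sup>-\<^sup>1\<close>.
\<close>

section \<open>Antisymmetric integer matrices\<close>

definition antisymmetric :: "('i \<Rightarrow> 'i \<Rightarrow> int) \<Rightarrow> bool"
  where "antisymmetric c \<longleftrightarrow> (\<forall>a b. c a b = - c b a)"

text \<open>\<open>shear j d c\<close> is the form \<open>c\<close> after the substitution \<open>x\<^sub>j \<mapsto> x\<^sub>j + \<Sum>\<^sub>a d\<^sub>a x\<^sub>a\<close>, provided \<open>c\<^sub>j\<^sub>j = 0\<close>.\<close>

definition shear :: "'i \<Rightarrow> ('i \<Rightarrow> int) \<Rightarrow> ('i \<Rightarrow> 'i \<Rightarrow> int) \<Rightarrow> 'i \<Rightarrow> 'i \<Rightarrow> int"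
  where "shear j d c = (\<lambda>a b. c a b + d a * c j b + c a j * d b)"

text \<open>Invariant of the reduction. \<open>J\<close> holds the indices still to be treated; the
  treated ones are decoupled from \<open>J\<close>, and \<open>S\<close> splits them into two
  classes without entries inside a class. Membership of elements of \<open>J\<close> in
  \<open>S\<close> carries no information.\<close>

definition bipartite_outside :: "'i set \<Rightarrow> 'i set \<Rightarrow> 'i set \<Rightarrow> ('i \<Rightarrow> 'i \<Rightarrow> int) \<Rightarrow> bool"
  where "bipartite_outside I J S c \<longleftrightarrow>
    (\<forall>a\<in>I - J. (\<forall>b\<in>J. c a b = 0) \<and> (\<forall>b\<in>I - J. (a \<in> S \<longleftrightarrow> b \<in> S) \<longrightarrow> c a b = 0))"

lemma antisymmetricD: "antisymmetric c \<Longrightarrow> c a b = - c b a"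
  unfolding antisymmetric_def by blast

lemma antisymmetric_diag: "antisymmetric c \<Longrightarrow> c a a = 0"
  using antisymmetricD[of c a a] by simp

lemma antisymmetric_shear: "antisymmetric c \<Longrightarrow> antisymmetric (shear j d c)"
  unfolding antisymmetric_def
proof (intro allI)
  fix a b assume "\<forall>a b. c a b = - c b a"
  then have "c a b = - c b a" "c a j = - c j a" "c b j = - c j b" by blast+
  then show "shear j d c a b = - shear j d c b a" by (simp add: shear_def)
qed

text \<open>For \<open>a\<close> in \<open>I - J\<close> both \<open>d a\<close> and
  \<open>c a j\<close> vanish, so the shear leaves row \<open>a\<close> alone, and the invariant
  speaks only of such rows.\<close>

lemma bipartite_outside_shear:
  assumes c: "bipartite_outside I J S c" and j: "j \<in> J" and d: "\<And>a. a \<notin> J \<Longrightarrow> d a = 0"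
  shows "bipartite_outside I J S (shear j d c)"
proof -
  have "shear j d c a b = c a b" if "a \<in> I - J" for a b
    using that c j d[of a] by (simp add: bipartite_outside_def shear_def)
  then show ?thesis using c unfolding bipartite_outside_def by metis
qed

text \<open>One Euclidean division along row \<open>i\<close>: adding multiples of column
  \<open>j\<close> to the other columns in \<open>J\<close> reduces row \<open>i\<close> modulo the
  pivot \<open>c i j\<close>. Row and column \<open>j\<close> survive because \<open>c j j\<close>
  and \<open>d j\<close> are zero.\<close>

lemma shear_pivot:
  fixes c :: "'i \<Rightarrow> 'i \<Rightarrow> int"
  assumes c: "antisymmetric c" and J: "bipartite_outside I J S c" and ij: "j \<in> J" "c i j \<noteq> 0"
  obtains d where "d j = 0"
    and "antisymmetric (shear j d c)" "bipartite_outside I J S (shear j d c)"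
    and "\<And>b. shear j d c j b = c j b" "\<And>b. shear j d c b j = c b j"
    and "\<And>b. b \<in> J \<Longrightarrow> b \<noteq> j \<Longrightarrow> shear j d c i b = c i b mod c i j"
proof -
  \<comment> \<open>Negated quotients by the pivot. The value 0 at \<open>j\<close> makes the
    substitution invertible, and the value 0 outside \<open>J\<close> protects the treated
    rows.\<close>
  define d where "d b = (if b \<in> J \<and> b \<noteq> j then - (c i b div c i j) else 0)" for b
  have dj: "d j = 0" by (simp add: d_def)
  have "bipartite_outside I J S (shear j d c)"
    by (rule bipartite_outside_shear[OF J ij(1)]) (simp add: d_def)
  moreover have "shear j d c j b = c j b" "shear j d c b j = c b j" for b
    using dj antisymmetric_diag[OF c, of j] by (simp_all add: shear_def)
  \<comment> \<open>Since \<open>c i i = 0\<close>, its quotient is zero, which removes the term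
    \<open>d i * c j b\<close> from row \<open>i\<close>.\<close>
  moreover have "d i = 0" using antisymmetric_diag[OF c, of i] by (simp add: d_def)
  then have "shear j d c i b = c i b mod c i j" if "b \<in> J" "b \<noteq> j" for b
    using that by (simp add: shear_def d_def minus_mult_div_eq_mod)
  ultimately show ?thesis using that[of d] dj antisymmetric_shear[OF c] by blast
qed

text \<open>
  The Euclidean form of the symplectic normal form: a nonzero entry in the part not yet treated
  either divides its row and its column, which can then be cleared, or shearing produces a smaller
  nonzero entry.
\<close>

lemma antisymmetric_induct [consumes 2, case_names bipartite shear]:
  fixes c :: "'i \<Rightarrow> 'i \<Rightarrow> int"
  assumes "finite I" and c: "antisymmetric c"
    and bip: "\<And>c S. antisymmetric c \<Longrightarrow> (\<And>a b. a \<in> I \<Longrightarrow> b \<in> I \<Longrightarrow> (a \<in> S \<longleftrightarrow> b \<in> S) \<Longrightarrow> c a b = 0) \<Longrightarrow> P c"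
    and step: "\<And>c j d. antisymmetric c \<Longrightarrow> j \<in> I \<Longrightarrow> d j = 0 \<Longrightarrow> P (shear j d c) \<Longrightarrow> P c"
  shows "P c"
proof -
  \<comment> \<open>Outer induction on the number of untreated indices; \<open>S\<close> must vary,
    since the colouring is extended as pairs are split off.\<close>
  have "P c" if "J \<subseteq> I" "antisymmetric c" "bipartite_outside I J S c" for J S and c :: "'i \<Rightarrow> 'i \<Rightarrow> int"
    using that
  proof (induction "card J" arbitrary: J S c rule: less_induct)
    case (less J S c)
    note outer = less(1) and sub = less(2)
    \<comment> \<open>Inner induction on the absolute value of the pivot with \<open>J\<close>
      fixed: any nonzero remainder serves as a smaller pivot, and if there is none, the pair
      \<open>i\<close>, \<open>j\<close> splits off.\<close>
    have pivot: "P c" if "antisymmetric c" "bipartite_outside I J S c" "i \<in> J" "j \<in> J" "c i j \<noteq> 0"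
      for c i j
      using that
    proof (induction "nat \<bar>c i j\<bar>" arbitrary: c i j rule: less_induct)
      case (less c i j)
      note hyp = less(1)
      have i: "i \<in> I" and j: "j \<in> I" using \<open>J \<subseteq> I\<close> less.prems by auto
      have "i \<noteq> j" using less.prems antisymmetric_diag by metis
      obtain d where d: "d j = 0"
        and c1: "antisymmetric (shear j d c)" "bipartite_outside I J S (shear j d c)"
          "\<And>b. shear j d c j b = c j b" "\<And>b. shear j d c b j = c b j"
        and row: "\<And>b. b \<in> J \<Longrightarrow> b \<noteq> j \<Longrightarrow> shear j d c i b = c i b mod c i j"
        using shear_pivot[OF less.prems(1,2,4,5)] by blast
      have "P (shear j d c)"
      proof (cases "\<exists>b\<in>J. b \<noteq> j \<and> shear j d c i b \<noteq> 0")
        case True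
        then obtain b where b: "b \<in> J" "b \<noteq> j" "shear j d c i b \<noteq> 0" by blast
        have "\<bar>shear j d c i b\<bar> < \<bar>c i j\<bar>"
          using row[OF b(1,2)] abs_mod_less[OF less.prems(5)] by simp
        then show ?thesis using hyp[of "shear j d c" i b] c1 b less.prems by simp
      next
        case False
        define c1 where "c1 = shear j d c"
        have zero: "c1 i b = 0" if "b \<in> J" "b \<noteq> j" for b using False that unfolding c1_def by blast
        \<comment> \<open>The transposed entry has the same absolute value, so row \<open>j\<close>
          can be divided by it in the same way, and its remainders are again smaller than the
          original pivot.\<close>
        have anti: "c1 j i = - c i j"
          using c1(3)[of i] antisymmetricD[OF less.prems(1), of j i] by (simp add: c1_def)
        obtain e where e: "e i = 0"
          and c2: "antisymmetric (shear i e c1)" "bipartite_outside I J S (shear i e c1)"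
            "\<And>b. shear i e c1 i b = c1 i b" "\<And>b. shear i e c1 b i = c1 b i"
          and row2: "\<And>b. b \<in> J \<Longrightarrow> b \<noteq> i \<Longrightarrow> shear i e c1 j b = c1 j b mod c1 j i"
          using shear_pivot[of c1 I J S i j] c1(1,2) less.prems(3,5) anti unfolding c1_def[symmetric] by auto
        define c2 where "c2 = shear i e c1"
        have "P c2"
        proof (cases "\<exists>b\<in>J. b \<noteq> i \<and> c2 j b \<noteq> 0")
          case True
          then obtain b where b: "b \<in> J" "b \<noteq> i" "c2 j b \<noteq> 0" by blast
          have "\<bar>c2 j b\<bar> < \<bar>c i j\<bar>"
            using row2[OF b(1,2)] abs_mod_less[of "c1 j i" "c1 j b"] less.prems(5) anti
            by (simp add: c2_def)
          then show ?thesis using hyp[of c2 j b] c2 b less.prems by (simp add: c2_def)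
        next
          case False
          \<comment> \<open>The second shear fixes row \<open>i\<close>, so the entries cleared by
            the first one stay zero.\<close>
          have zi: "c2 i b = 0" if "b \<in> J" "b \<noteq> j" for b using zero[OF that] c2(3) by (simp add: c2_def)
          have zj: "c2 j b = 0" if "b \<in> J" "b \<noteq> i" for b using False that by blast
          have a2: "antisymmetric c2" and b2: "bipartite_outside I J S c2" using c2 by (simp_all add: c2_def)
          have out: "c2 a b = 0" "c2 b a = 0" if "a \<in> I - J" "b \<in> J" for a b
            using b2 that antisymmetricD[OF a2, of b a] by (auto simp: bipartite_outside_def)
          \<comment> \<open>Putting \<open>i\<close> into \<open>S\<close> and \<open>j\<close>
            outside it places the one surviving entry of the pair, up to sign, between the two
            classes.\<close>
          have "bipartite_outside I (J - {i, j}) (insert i S - {j}) c2"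
            unfolding bipartite_outside_def
          proof (intro ballI conjI impI)
            fix a b assume "a \<in> I - (J - {i, j})" "b \<in> J - {i, j}"
            then show "c2 a b = 0" using out zi zj by blast
          next
            fix a b assume "a \<in> I - (J - {i, j})" "b \<in> I - (J - {i, j})"
              "(a \<in> insert i S - {j}) = (b \<in> insert i S - {j})"
            then show "c2 a b = 0"
              using out zi zj b2 \<open>i \<noteq> j\<close> less.prems(3,4) unfolding bipartite_outside_def by blast
          qed
          moreover have "card (J - {i, j}) < card J"
            using \<open>i \<in> J\<close> \<open>J \<subseteq> I\<close> \<open>finite I\<close> by (intro psubset_card_mono) (auto intro: finite_subset)
          ultimately show ?thesis using outer a2 \<open>J \<subseteq> I\<close> by blast
        qed
        then show ?thesis using step[of c1 i e] c1(1) i e by (simp add: c1_def c2_def)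
      qed
      then show ?case using step[of c j d] less.prems(1) j d by blast
    qed
    show ?case
    proof (cases "\<exists>i\<in>J. \<exists>j\<in>J. c i j \<noteq> 0")
      case True
      then show ?thesis using pivot less.prems by blast
    next
      case False
      \<comment> \<open>With no nonzero entry left inside \<open>J\<close>, the set \<open>S\<close>
        colours all of \<open>I\<close>, whichever way the elements of \<open>J\<close>
        fall.\<close>
      have "c a b = 0" if "a \<in> I" "b \<in> I" "a \<in> S \<longleftrightarrow> b \<in> S" for a b
        using that False less.prems antisymmetricD[OF less.prems(2), of a b]
        unfolding bipartite_outside_def by (cases "a \<in> J"; cases "b \<in> J") auto
      then show ?thesis using bip less.prems by blast
    qed
  qed
  \<comment> \<open>At the start \<open>J = I\<close>, and the invariant is vacuous.\<close>
  then show ?thesis using c by (force simp: bipartite_outside_def)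
qed


section \<open>Fibres of biaffine maps\<close>

text \<open>By Lagrange, since the cosets of the kernel inject into the codomain.\<close>

lemma (in group_hom) order_le_card_kernel:
  assumes "finite (carrier H)"
  shows "order G \<le> card (carrier H) * card (kernel G H h)"
proof -
  have "card (rcosets kernel G H h) \<le> card (carrier H)"
    using FactGroup_hom assms card_inj_on_le[OF FactGroup_inj_on]
    by (auto simp: FactGroup_def hom_def image_subset_iff_funcset)
  then show ?thesis
    using G.lagrange[OF subgroup_kernel] by (metis mult_le_mono1)
qed

text \<open>At each point the increment of \<open>f\<close> along \<open>K\<close>, or along
  \<open>L\<close>, is a homomorphism, so at least a fraction 1/|H| of the translations keep the
  value. Moving from \<open>z\<close> first along \<open>K\<close> and then along \<open>L\<close>
  loses this factor twice, and the endpoints are distinct because \<open>K\<close> and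
  \<open>L\<close> meet trivially.\<close>

lemma card_biaffine_fibre:
  fixes M :: "('a, 'c) monoid_scheme" and H :: "('b, 'd) monoid_scheme"
  assumes "group M" and fin: "finite (carrier M)" and "group H" and finH: "finite (carrier H)"
    and K: "subgroup K M" "subgroup L M" and disj: "K \<inter> L = {\<one>\<^bsub>M\<^esub>}"
    and f: "f \<in> carrier M \<rightarrow> carrier H"
    and hK: "\<And>x. x \<in> carrier M \<Longrightarrow> (\<lambda>t. inv\<^bsub>H\<^esub> f x \<otimes>\<^bsub>H\<^esub> f (x \<otimes>\<^bsub>M\<^esub> t)) \<in> hom (M\<lparr>carrier := K\<rparr>) H"
    and hL: "\<And>x. x \<in> carrier M \<Longrightarrow> (\<lambda>t. inv\<^bsub>H\<^esub> f x \<otimes>\<^bsub>H\<^esub> f (x \<otimes>\<^bsub>M\<^esub> t)) \<in> hom (M\<lparr>carrier := L\<rparr>) H"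
    and z: "z \<in> carrier M"
  shows "card K * card L \<le> (card (carrier H))\<^sup>2 * card {x \<in> carrier M. f x = f z}"
proof -
  interpret M: group M by fact
  interpret H: group H by fact
  let ?h = "card (carrier H)"
  have sub: "K \<subseteq> carrier M" "L \<subseteq> carrier M" using K by (auto dest: subgroup.subset)
  define N where "N = {x \<in> carrier M. f x = f z}"
  \<comment> \<open>For the subgroups used here this is the kernel of the increment homomorphism at
    \<open>x\<close>.\<close>
  define stab where "stab A x = {t \<in> A. f (x \<otimes>\<^bsub>M\<^esub> t) = f x}" for A x
  have stab: "card A \<le> ?h * card (stab A x)"
    if A: "subgroup A M" and x: "x \<in> carrier M"
      and h: "(\<lambda>t. inv\<^bsub>H\<^esub> f x \<otimes>\<^bsub>H\<^esub> f (x \<otimes>\<^bsub>M\<^esub> t)) \<in> hom (M\<lparr>carrier := A\<rparr>) H" for A x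
  proof -
    have subA: "A \<subseteq> carrier M" using A by (rule subgroup.subset)
    interpret A: group "M\<lparr>carrier := A\<rparr>" using M.subgroup_imp_group[OF A] .
    interpret h: group_hom "M\<lparr>carrier := A\<rparr>" H "\<lambda>t. inv\<^bsub>H\<^esub> f x \<otimes>\<^bsub>H\<^esub> f (x \<otimes>\<^bsub>M\<^esub> t)"
      using h by unfold_locales
    have "inv\<^bsub>H\<^esub> f x \<otimes>\<^bsub>H\<^esub> f (x \<otimes>\<^bsub>M\<^esub> t) = \<one>\<^bsub>H\<^esub> \<longleftrightarrow> f (x \<otimes>\<^bsub>M\<^esub> t) = f x" if "t \<in> A" for t
    proof -
      have "f x \<in> carrier H" "f (x \<otimes>\<^bsub>M\<^esub> t) \<in> carrier H" using f x that subA by auto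
      then show ?thesis by (metis H.inv_closed H.inv_equality H.inv_inv H.l_inv)
    qed
    then have "kernel (M\<lparr>carrier := A\<rparr>) H (\<lambda>t. inv\<^bsub>H\<^esub> f x \<otimes>\<^bsub>H\<^esub> f (x \<otimes>\<^bsub>M\<^esub> t)) = stab A x"
      by (auto simp: kernel_def stab_def)
    then show ?thesis using h.order_le_card_kernel[OF finH] by (simp add: order_def)
  qed
  \<comment> \<open>A dependent sum: the admissible second moves depend on the point reached by the
    first.\<close>
  define D where "D = (SIGMA t : stab K z. stab L (z \<otimes>\<^bsub>M\<^esub> t))"
  have "card L \<le> ?h * card (stab L (z \<otimes>\<^bsub>M\<^esub> t))" if "t \<in> stab K z" for t
    using that sub z by (intro stab K hL) (auto simp: stab_def)
  then have "(\<Sum>t\<in>stab K z. card L) \<le> (\<Sum>t\<in>stab K z. ?h * card (stab L (z \<otimes>\<^bsub>M\<^esub> t)))"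
    by (rule sum_mono)
  moreover have finite: "finite K" "finite L" using fin sub by (auto intro: finite_subset)
  ultimately have D: "card (stab K z) * card L \<le> ?h * card D"
    unfolding D_def by (subst card_SigmaI) (auto simp: stab_def sum_distrib_left)
  have "inj_on (\<lambda>(t, s). z \<otimes>\<^bsub>M\<^esub> t \<otimes>\<^bsub>M\<^esub> s) D"
  proof (rule inj_onI)
    fix u u' assume u: "u \<in> D" "u' \<in> D"
      and eq: "(\<lambda>(t, s). z \<otimes>\<^bsub>M\<^esub> t \<otimes>\<^bsub>M\<^esub> s) u = (\<lambda>(t, s). z \<otimes>\<^bsub>M\<^esub> t \<otimes>\<^bsub>M\<^esub> s) u'"
    obtain t s t' s' where uts: "u = (t, s)" "u' = (t', s')" by fastforce
    have ts: "t \<in> K" "t' \<in> K" "s \<in> L" "s' \<in> L" using u unfolding uts D_def stab_def by blast+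
    then have car: "t \<in> carrier M" "t' \<in> carrier M" "s \<in> carrier M" "s' \<in> carrier M"
      using sub by blast+
    have "t \<otimes>\<^bsub>M\<^esub> s = t' \<otimes>\<^bsub>M\<^esub> s'" using eq car z by (simp add: uts M.m_assoc)
    then have "inv\<^bsub>M\<^esub> t' \<otimes>\<^bsub>M\<^esub> (t \<otimes>\<^bsub>M\<^esub> s) \<otimes>\<^bsub>M\<^esub> inv\<^bsub>M\<^esub> s = inv\<^bsub>M\<^esub> t' \<otimes>\<^bsub>M\<^esub> (t' \<otimes>\<^bsub>M\<^esub> s') \<otimes>\<^bsub>M\<^esub> inv\<^bsub>M\<^esub> s"
      by simp
    \<comment> \<open>The two sides lie in \<open>K\<close> and in \<open>L\<close> respectively, so
      both are trivial.\<close>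
    then have e: "inv\<^bsub>M\<^esub> t' \<otimes>\<^bsub>M\<^esub> t = s' \<otimes>\<^bsub>M\<^esub> inv\<^bsub>M\<^esub> s"
      using car by (simp add: M.inv_solve_right M.m_assoc) (simp add: M.m_assoc[symmetric])
    have "inv\<^bsub>M\<^esub> t' \<otimes>\<^bsub>M\<^esub> t \<in> K" "s' \<otimes>\<^bsub>M\<^esub> inv\<^bsub>M\<^esub> s \<in> L"
      using K ts by (blast intro: subgroup.m_closed subgroup.m_inv_closed)+
    then have "inv\<^bsub>M\<^esub> t' \<otimes>\<^bsub>M\<^esub> t = \<one>\<^bsub>M\<^esub>" "s' \<otimes>\<^bsub>M\<^esub> inv\<^bsub>M\<^esub> s = \<one>\<^bsub>M\<^esub>" using e disj by auto
    then have "t = t'" "s' = s"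
      using M.inv_solve_left'[of "\<one>\<^bsub>M\<^esub>" t' t] M.inv_solve_right'[of "\<one>\<^bsub>M\<^esub>" s' s] car by simp_all
    then show "u = u'" by (simp add: uts)
  qed
  moreover have "(\<lambda>(t, s). z \<otimes>\<^bsub>M\<^esub> t \<otimes>\<^bsub>M\<^esub> s) ` D \<subseteq> N"
    using z sub by (auto simp: D_def N_def stab_def)
  moreover have "finite N" using fin by (simp add: N_def)
  ultimately have "card D \<le> card N" by (metis card_inj_on_le)
  have "card K * card L \<le> ?h * card (stab K z) * card L"
    using stab[OF K(1) z hK[OF z]] by (rule mult_le_mono1)
  also have "\<dots> \<le> ?h * (?h * card D)" using D by (simp add: mult.assoc)
  also have "\<dots> \<le> ?h\<^sup>2 * card N" using \<open>card D \<le> card N\<close> by (simp add: power2_eq_square)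
  finally show ?thesis by (simp add: N_def)
qed


section \<open>Quadratic maps on an abelian group\<close>

context comm_group
begin

lemma finprod_int_pow:
  assumes "f \<in> I \<rightarrow> carrier G"
  shows "(\<Otimes>i\<in>I. f i) [^] (n :: int) = (\<Otimes>i\<in>I. f i [^] n)"
  using assms by (induction I rule: infinite_finite_induct) (auto simp: int_pow_distrib Pi_iff)

definition lin :: "'i set \<Rightarrow> ('i \<Rightarrow> int) \<Rightarrow> ('i \<Rightarrow> 'a) \<Rightarrow> 'a"
  where "lin I v x = (\<Otimes>i\<in>I. x i [^] v i)"

lemma lin_closed [simp]: "x \<in> I \<rightarrow> carrier G \<Longrightarrow> lin I v x \<in> carrier G"
  unfolding lin_def by (rule finprod_closed) auto

lemma lin_add:
  assumes "x \<in> I \<rightarrow> carrier G"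
  shows "lin I (\<lambda>i. u i + v i) x = lin I u x \<otimes> lin I v x"
proof -
  have "lin I (\<lambda>i. u i + v i) x = (\<Otimes>i\<in>I. x i [^] u i \<otimes> x i [^] v i)"
    unfolding lin_def using assms by (intro finprod_cong') (auto simp: int_pow_mult Pi_iff)
  then show ?thesis unfolding lin_def using assms by (simp add: Pi_iff)
qed

lemma lin_scale:
  assumes "x \<in> I \<rightarrow> carrier G"
  shows "lin I (\<lambda>i. n * v i) x = lin I v x [^] n"
proof -
  have "lin I v x [^] n = (\<Otimes>i\<in>I. (x i [^] v i) [^] n)"
    unfolding lin_def using assms by (intro finprod_int_pow) auto
  also have "\<dots> = lin I (\<lambda>i. n * v i) x"
    unfolding lin_def using assms by (intro finprod_cong') (auto simp: int_pow_pow mult.commute Pi_iff)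
  finally show ?thesis by simp
qed

lemma lin_mult:
  assumes "x \<in> I \<rightarrow> carrier G" "y \<in> I \<rightarrow> carrier G"
  shows "lin I v (\<lambda>i\<in>I. x i \<otimes> y i) = lin I v x \<otimes> lin I v y"
proof -
  have "lin I v (\<lambda>i\<in>I. x i \<otimes> y i) = (\<Otimes>i\<in>I. x i [^] v i \<otimes> y i [^] v i)"
    unfolding lin_def using assms by (intro finprod_cong') (auto simp: int_pow_distrib Pi_iff)
  then show ?thesis unfolding lin_def using assms by (simp add: Pi_iff)
qed

lemma lin_single:
  assumes "finite I" "j \<in> I" "x \<in> I \<rightarrow> carrier G"
  shows "lin I (\<lambda>i. if i = j then n else 0) x = x j [^] n"
proof -
  have "lin I (\<lambda>i. if i = j then n else 0) x = (\<Otimes>i\<in>I. if i = j then x i [^] n else \<one>)"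
    unfolding lin_def using assms by (intro finprod_cong') (auto simp: Pi_iff)
  then show ?thesis
    using finprod_singleton_swap[OF assms(2,1), of "\<lambda>i. x i [^] n"] assms by auto
qed

lemma lin_shear:
  assumes "finite I" "j \<in> I" and x: "x \<in> I \<rightarrow> carrier G" and y: "y \<in> carrier G"
  shows "lin I v (x(j := x j \<otimes> y)) = lin I v x \<otimes> y [^] v j"
proof -
  have "lin I v (x(j := x j \<otimes> y)) = (\<Otimes>i\<in>I. x i [^] v i \<otimes> (if i = j then y [^] v i else \<one>))"
    unfolding lin_def using x y by (intro finprod_cong') (auto simp: int_pow_distrib Pi_iff)
  also have "\<dots> = lin I v x \<otimes> (\<Otimes>i\<in>I. if i = j then y [^] v i else \<one>)"
    unfolding lin_def using x y by (intro finprod_multf) auto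
  finally show ?thesis
    using finprod_singleton_swap[OF assms(2,1), of "\<lambda>i. y [^] v i"] y by simp
qed

end

section \<open>Quadratic maps of a bilinear pairing and their fibres\<close>

locale bilinear_pairing = comm_group +
  fixes \<beta> :: "'a \<Rightarrow> 'a \<Rightarrow> 'a"
  assumes beta_closed [simp]: "x \<in> carrier G \<Longrightarrow> y \<in> carrier G \<Longrightarrow> \<beta> x y \<in> carrier G"
    and beta_mult_left: "x \<in> carrier G \<Longrightarrow> y \<in> carrier G \<Longrightarrow> z \<in> carrier G \<Longrightarrow> \<beta> (x \<otimes> y) z = \<beta> x z \<otimes> \<beta> y z"
    and beta_mult_right: "x \<in> carrier G \<Longrightarrow> y \<in> carrier G \<Longrightarrow> z \<in> carrier G \<Longrightarrow> \<beta> x (y \<otimes> z) = \<beta> x y \<otimes> \<beta> x z"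
begin

lemma hom_beta_left: "z \<in> carrier G \<Longrightarrow> group_hom G G (\<lambda>x. \<beta> x z)"
  by (simp add: group_hom_def group_hom_axioms_def is_group hom_def beta_mult_left)

lemma hom_beta_right: "z \<in> carrier G \<Longrightarrow> group_hom G G (\<beta> z)"
  by (simp add: group_hom_def group_hom_axioms_def is_group hom_def beta_mult_right)

lemma beta_one [simp]: "z \<in> carrier G \<Longrightarrow> \<beta> \<one> z = \<one>" "z \<in> carrier G \<Longrightarrow> \<beta> z \<one> = \<one>"
  using group_hom.hom_one[OF hom_beta_left] group_hom.hom_one[OF hom_beta_right] by auto

lemma beta_int_pow:
  assumes "x \<in> carrier G" "y \<in> carrier G"
  shows "\<beta> (x [^] (n :: int)) y = \<beta> x y [^] n" "\<beta> x (y [^] (n :: int)) = \<beta> x y [^] n"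
  using assms group_hom.hom_int_pow[OF hom_beta_left, of y x n]
    group_hom.hom_int_pow[OF hom_beta_right, of x y n] by auto

lemma beta_lin_left:
  assumes "x \<in> I \<rightarrow> carrier G" and z: "z \<in> carrier G"
  shows "\<beta> (lin I v x) z = (\<Otimes>i\<in>I. \<beta> (x i) z [^] v i)"
  unfolding lin_def using assms(1)
  by (induction I rule: infinite_finite_induct) (auto simp: z beta_mult_left beta_int_pow Pi_iff)

text \<open>The form \<Sum> c_ij \<beta>(x_i, y_j), with the inner sum taken inside the second
  argument so that only single products occur.\<close>

definition bil :: "'i set \<Rightarrow> ('i \<Rightarrow> 'i \<Rightarrow> int) \<Rightarrow> ('i \<Rightarrow> 'a) \<Rightarrow> ('i \<Rightarrow> 'a) \<Rightarrow> 'a"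
  where "bil I c x y = (\<Otimes>i\<in>I. \<beta> (x i) (lin I (c i) y))"

text \<open>The quadratic map \<open>\<Sum>\<^sub>i a\<^sub>i x\<^sub>i + \<Sum>\<^sub>i\<^sub>j c\<^sub>i\<^sub>j \<beta>(x\<^sub>i, x\<^sub>j)\<close>, in multiplicative notation.\<close>

definition quadratic :: "'i set \<Rightarrow> ('i \<Rightarrow> int) \<Rightarrow> ('i \<Rightarrow> 'i \<Rightarrow> int) \<Rightarrow> ('i \<Rightarrow> 'a) \<Rightarrow> 'a"
  where "quadratic I a c x = lin I a x \<otimes> bil I c x x"

lemma bil_closed [simp]:
  "x \<in> I \<rightarrow> carrier G \<Longrightarrow> y \<in> I \<rightarrow> carrier G \<Longrightarrow> bil I c x y \<in> carrier G"
  unfolding bil_def by (rule finprod_closed) (simp add: Pi_iff)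

lemma quadratic_closed [simp]: "x \<in> I \<rightarrow> carrier G \<Longrightarrow> quadratic I a c x \<in> carrier G"
  by (simp add: quadratic_def)

lemma bil_mult_left:
  assumes "x \<in> I \<rightarrow> carrier G" "x' \<in> I \<rightarrow> carrier G" "y \<in> I \<rightarrow> carrier G"
  shows "bil I c (\<lambda>i\<in>I. x i \<otimes> x' i) y = bil I c x y \<otimes> bil I c x' y"
proof -
  have "bil I c (\<lambda>i\<in>I. x i \<otimes> x' i) y = (\<Otimes>i\<in>I. \<beta> (x i) (lin I (c i) y) \<otimes> \<beta> (x' i) (lin I (c i) y))"
    unfolding bil_def using assms by (intro finprod_cong') (auto simp: beta_mult_left Pi_iff)
  then show ?thesis unfolding bil_def using assms by (simp add: Pi_iff)
qed

lemma bil_mult_right: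
  assumes "x \<in> I \<rightarrow> carrier G" "y \<in> I \<rightarrow> carrier G" "y' \<in> I \<rightarrow> carrier G"
  shows "bil I c x (\<lambda>i\<in>I. y i \<otimes> y' i) = bil I c x y \<otimes> bil I c x y'"
proof -
  have "bil I c x (\<lambda>i\<in>I. y i \<otimes> y' i) = (\<Otimes>i\<in>I. \<beta> (x i) (lin I (c i) y) \<otimes> \<beta> (x i) (lin I (c i) y'))"
    unfolding bil_def using assms by (intro finprod_cong') (auto simp: lin_mult beta_mult_right Pi_iff)
  then show ?thesis unfolding bil_def using assms by (simp add: Pi_iff)
qed

text \<open>With D = \<open>lin I d x\<close>, the increment of x_j in the first argument
  contributes \<beta>(D, \<Sum> c_jb x_b), which spreads over the x_i with weights d_i; in the
  second argument it contributes c_ij D. These are the two correction terms of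
  \<open>shear\<close>.\<close>

lemma quadratic_shear:
  assumes I: "finite I" "j \<in> I" and x: "x \<in> I \<rightarrow> carrier G" and c: "c j j = 0"
  shows "quadratic I a c (x(j := x j \<otimes> lin I d x)) = quadratic I (\<lambda>i. a i + a j * d i) (shear j d c) x"
proof -
  define D where "D = lin I d x"
  define x' where "x' = x(j := x j \<otimes> D)"
  have D: "D \<in> carrier G" and xi: "\<And>i. i \<in> I \<Longrightarrow> x i \<in> carrier G" and x': "x' \<in> I \<rightarrow> carrier G"
    using x I by (auto simp: D_def x'_def Pi_iff)
  have lin': "lin I v x' = lin I v x \<otimes> D [^] v j" for v
    unfolding x'_def by (rule lin_shear[OF I x D])
  let ?R = "\<Otimes>i\<in>I. \<beta> (x i) (lin I (c i) x')"
  have "bil I c x' x' = (\<Otimes>i\<in>I. \<beta> (x i) (lin I (c i) x') \<otimes> (if i = j then \<beta> D (lin I (c i) x') else \<one>))"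
    unfolding bil_def
  proof (rule finprod_cong'[OF refl], goal_cases)
    case 1
    show ?case using xi D x' by (simp add: Pi_iff)
  next
    case (2 i)
    have "x' i = (if i = j then x i \<otimes> D else x i)" by (simp add: x'_def)
    then show ?case using xi[of i] 2 D x' by (auto simp: beta_mult_left)
  qed
  also have "\<dots> = ?R \<otimes> (\<Otimes>i\<in>I. if i = j then \<beta> D (lin I (c i) x') else \<one>)"
    using xi D x' by (intro finprod_multf) auto
  also have "(\<Otimes>i\<in>I. if i = j then \<beta> D (lin I (c i) x') else \<one>) = \<beta> D (lin I (c j) x')"
    using D x' by (intro finprod_singleton_swap I) auto
  \<comment> \<open>The altered variable enters here with coefficient \<open>c j j = 0\<close>, so
    no term quadratic in D arises.\<close>
  also have "lin I (c j) x' = lin I (c j) x" using c x by (simp add: lin')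
  also have "\<beta> D (lin I (c j) x) = (\<Otimes>i\<in>I. \<beta> (x i) (lin I (c j) x) [^] d i)"
    unfolding D_def using x by (intro beta_lin_left) auto
  also have "?R \<otimes> \<dots> = (\<Otimes>i\<in>I. \<beta> (x i) (lin I (c i) x') \<otimes> \<beta> (x i) (lin I (c j) x) [^] d i)"
    using xi x x' by (intro finprod_multf[symmetric]) auto
  also have "\<dots> = bil I (shear j d c) x x"
    unfolding bil_def
  proof (rule finprod_cong'[OF refl], goal_cases)
    case 1
    show ?case using xi x by (simp add: Pi_iff)
  next
    case (2 i)
    have "lin I (shear j d c i) x = lin I (c i) x \<otimes> lin I (c j) x [^] d i \<otimes> D [^] c i j"
      unfolding shear_def using x by (simp add: lin_add lin_scale D_def)
    then show ?case
      using xi[of i] 2 x D by (simp add: lin' beta_mult_right beta_int_pow m_ac)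
  qed
  finally have "bil I c x' x' = bil I (shear j d c) x x" .
  moreover have "lin I a x' = lin I (\<lambda>i. a i + a j * d i) x"
    using x by (simp add: lin' lin_add lin_scale D_def)
  ultimately show ?thesis by (simp add: quadratic_def x'_def D_def)
qed

lemma quadratic_mult:
  assumes x: "x \<in> I \<rightarrow> carrier G" and y: "y \<in> I \<rightarrow> carrier G"
  shows "quadratic I a c (\<lambda>i\<in>I. x i \<otimes> y i)
    = quadratic I a c x \<otimes> (quadratic I a c y \<otimes> (bil I c x y \<otimes> bil I c y x))"
proof -
  have xy: "(\<lambda>i\<in>I. x i \<otimes> y i) \<in> I \<rightarrow> carrier G" using x y by (auto simp: Pi_iff)
  show ?thesis
    unfolding quadratic_def using x y xy
    by (simp add: lin_mult bil_mult_left bil_mult_right m_ac)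
qed

text \<open>\<open>K S\<close> consists of the tuples supported on \<open>S\<close>. There the
  bilinear part vanishes, because \<open>c\<close> has no entries inside \<open>S\<close>, and the
  increment reduces to the linear part and the cross terms with \<open>x\<close>, all additive in
  \<open>t\<close>.\<close>

lemma quadratic_translate_hom:
  fixes I :: "'i set" and c :: "'i \<Rightarrow> 'i \<Rightarrow> int"
  defines "M \<equiv> product_group I (\<lambda>_. G)" and "K \<equiv> (\<lambda>S. \<Pi>\<^sub>E i\<in>I. if i \<in> S then carrier G else {\<one>})"
  assumes c: "\<And>i j. i \<in> I \<Longrightarrow> j \<in> I \<Longrightarrow> i \<in> S \<Longrightarrow> j \<in> S \<Longrightarrow> c i j = 0" and x: "x \<in> carrier M"
  shows "(\<lambda>t. inv quadratic I a c x \<otimes> quadratic I a c (x \<otimes>\<^bsub>M\<^esub> t)) \<in> hom (M\<lparr>carrier := K S\<rparr>) G"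
proof -
  have xP: "x \<in> I \<rightarrow> carrier G" using x by (auto simp: M_def)
  have KP: "t \<in> I \<rightarrow> carrier G" if "t \<in> K S" for t
    using that by (fastforce simp: K_def PiE_iff split: if_splits)
  have zero: "bil I c s t = \<one>" if s: "s \<in> K S" and t: "t \<in> K S" for s t
    unfolding bil_def
  proof (rule finprod_one_eqI)
    fix i assume i: "i \<in> I"
    have li: "lin I (c i) t \<in> carrier G" using KP[OF t] by simp
    show "\<beta> (s i) (lin I (c i) t) = \<one>"
    proof (cases "i \<in> S")
      case True
      have "t j [^] c i j = \<one>" if "j \<in> I" for j
      proof (cases "j \<in> S")
        case False
        then have "t j = \<one>" using t \<open>j \<in> I\<close> by (auto simp: K_def PiE_iff)
        then show ?thesis by simp
      qed (use c[of i j] i True that in simp)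
      then have "lin I (c i) t = \<one>" unfolding lin_def by (intro finprod_one_eqI)
      then show ?thesis using Pi_mem[OF KP[OF s] i] by simp
    next
      case False
      then have "s i = \<one>" using s i by (auto simp: K_def PiE_iff)
      then show ?thesis using li by simp
    qed
  qed
  \<comment> \<open>The polarisation of the quadratic map at \<open>x\<close>, without the vanishing
    term \<open>bil I c t t\<close>.\<close>
  define \<theta> where "\<theta> t = lin I a t \<otimes> (bil I c x t \<otimes> bil I c t x)" for t
  have eq: "inv quadratic I a c x \<otimes> quadratic I a c (x \<otimes>\<^bsub>M\<^esub> t) = \<theta> t" if t: "t \<in> K S" for t
  proof -
    have "quadratic I a c t = lin I a t" using zero[OF t t] KP[OF t] by (simp add: quadratic_def)
    then show ?thesis
      using xP KP[OF t] by (simp add: M_def quadratic_mult \<theta>_def m_assoc[symmetric])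
  qed
  have mult: "s \<otimes>\<^bsub>M\<^esub> t \<in> K S" if "s \<in> K S" "t \<in> K S" for s t
    using that by (fastforce simp: M_def K_def PiE_iff split: if_splits)
  show ?thesis
  proof (rule homI)
    fix t assume "t \<in> carrier (M\<lparr>carrier := K S\<rparr>)"
    then have t: "t \<in> K S" by simp
    show "inv quadratic I a c x \<otimes> quadratic I a c (x \<otimes>\<^bsub>M\<^esub> t) \<in> carrier G"
      unfolding eq[OF t] using KP[OF t] xP by (simp add: \<theta>_def)
  next
    fix s t assume "s \<in> carrier (M\<lparr>carrier := K S\<rparr>)" "t \<in> carrier (M\<lparr>carrier := K S\<rparr>)"
    then have st: "s \<in> K S" "t \<in> K S" by simp_all
    have "\<theta> (s \<otimes>\<^bsub>M\<^esub> t) = \<theta> s \<otimes> \<theta> t"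
      using st[THEN KP] xP by (simp add: M_def \<theta>_def lin_mult bil_mult_left bil_mult_right m_ac)
    then show "inv quadratic I a c x \<otimes> quadratic I a c (x \<otimes>\<^bsub>M\<^esub> (s \<otimes>\<^bsub>M\<lparr>carrier := K S\<rparr>\<^esub> t))
        = (inv quadratic I a c x \<otimes> quadratic I a c (x \<otimes>\<^bsub>M\<^esub> s)) \<otimes> (inv quadratic I a c x \<otimes> quadratic I a c (x \<otimes>\<^bsub>M\<^esub> t))"
      using eq[OF mult[OF st]] eq[OF st(1)] eq[OF st(2)] by simp
  qed
qed

text \<open>The two subgroups are the tuples supported on \<open>S\<close> and on its complement; in
  each coordinate one contributes |G| and the other 1, so their orders multiply to |G|^|I|.\<close>

lemma card_quadratic_fibre_bipartite:
  fixes I :: "'i set" and c :: "'i \<Rightarrow> 'i \<Rightarrow> int"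
  assumes I: "finite I" and fin: "finite (carrier G)"
    and c: "\<And>i j. i \<in> I \<Longrightarrow> j \<in> I \<Longrightarrow> (i \<in> S \<longleftrightarrow> j \<in> S) \<Longrightarrow> c i j = 0"
    and z: "z \<in> (\<Pi>\<^sub>E i\<in>I. carrier G)"
  shows "order G ^ card I
    \<le> (order G)\<^sup>2 * card {x \<in> (\<Pi>\<^sub>E i\<in>I. carrier G). quadratic I a c x = quadratic I a c z}"
proof -
  define M where "M = product_group I (\<lambda>_. G)"
  define K where "K S = (\<Pi>\<^sub>E i\<in>I. if i \<in> S then carrier G else {\<one>})" for S
  have carM: "carrier M = (\<Pi>\<^sub>E i\<in>I. carrier G)" by (simp add: M_def)
  have sub: "subgroup (K T) M" for T
    unfolding K_def M_def using subgroup_self triv_subgroup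
    by (subst PiE_subgroup_product_group) (auto simp: is_group)
  have "card (K S) * card (K (- S)) \<le> (card (carrier G))\<^sup>2 *
      card {x \<in> carrier M. quadratic I a c x = quadratic I a c z}"
  proof (rule card_biaffine_fibre[OF _ _ is_group fin sub sub])
    show "group M" by (simp add: M_def is_group)
    show "finite (carrier M)" using I fin by (simp add: carM finite_PiE)
    show "K S \<inter> K (- S) = {\<one>\<^bsub>M\<^esub>}"
      unfolding K_def PiE_Int by (auto simp: M_def fun_eq_iff PiE_iff extensional_def split: if_splits)
    show "quadratic I a c \<in> carrier M \<rightarrow> carrier G" by (auto simp: carM intro!: quadratic_closed)
    show "(\<lambda>t. inv quadratic I a c x \<otimes> quadratic I a c (x \<otimes>\<^bsub>M\<^esub> t)) \<in> hom (M\<lparr>carrier := K S\<rparr>) G"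
      if "x \<in> carrier M" for x
      using quadratic_translate_hom[of I S c x a] that c unfolding M_def K_def by simp
    show "(\<lambda>t. inv quadratic I a c x \<otimes> quadratic I a c (x \<otimes>\<^bsub>M\<^esub> t)) \<in> hom (M\<lparr>carrier := K (- S)\<rparr>) G"
      if "x \<in> carrier M" for x
      using quadratic_translate_hom[of I "- S" c x a] that c unfolding M_def K_def by simp
    show "z \<in> carrier M" using z by (simp add: carM)
  qed
  moreover have "card (K S) * card (K (- S)) = order G ^ card I"
  proof -
    have "card (K S) * card (K (- S)) = (\<Prod>i\<in>I. order G)"
      unfolding K_def card_PiE[OF I] prod.distrib[symmetric] by (rule prod.cong) (auto simp: order_def)
    then show ?thesis by simp
  qed
  ultimately show ?thesis by (simp add: carM order_def)
qed

text \<open>A shear is induced by a permutation of the tuples and so preserves fibre sizes, which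
  reduces the claim to the bipartite case. It also changes the linear coefficients and the base
  point, hence the generalisation over \<open>a\<close> and \<open>z\<close>.\<close>

theorem card_quadratic_fibre:
  fixes I :: "'i set" and c :: "'i \<Rightarrow> 'i \<Rightarrow> int"
  assumes I: "finite I" and fin: "finite (carrier G)" and c: "antisymmetric c"
    and z: "z \<in> (\<Pi>\<^sub>E i\<in>I. carrier G)"
  shows "order G ^ card I
    \<le> (order G)\<^sup>2 * card {x \<in> (\<Pi>\<^sub>E i\<in>I. carrier G). quadratic I a c x = quadratic I a c z}"
  using I c z
proof (induction c arbitrary: a z rule: antisymmetric_induct)
  case (bipartite c S)
  then show ?case using card_quadratic_fibre_bipartite[OF I fin] by blast
next
  case (shear c j d)
  let ?P = "\<Pi>\<^sub>E i\<in>I. carrier G"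
  let ?a = "\<lambda>i. a i + a j * d i"
  define \<sigma> where "\<sigma> x = x(j := x j \<otimes> lin I d x)" for x
  \<comment> \<open>As \<open>d j = 0\<close>, the added amount can be read off the image; this
    yields injectivity of \<open>\<sigma>\<close>.\<close>
  have lin_\<sigma>: "lin I d (\<sigma> x) = lin I d x" if "x \<in> ?P" for x
    unfolding \<sigma>_def using lin_shear[OF I \<open>j \<in> I\<close>, of x "lin I d x" d] that \<open>d j = 0\<close> by (auto simp: PiE_def)
  have P\<sigma>: "\<sigma> x \<in> ?P" if "x \<in> ?P" for x
    using that \<open>j \<in> I\<close> by (auto simp: \<sigma>_def PiE_iff extensional_def)
  have inj: "inj_on \<sigma> ?P"
  proof (rule inj_onI)
    fix x y assume xy: "x \<in> ?P" "y \<in> ?P" "\<sigma> x = \<sigma> y"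
    then have l: "lin I d x = lin I d y" using lin_\<sigma> by metis
    have "x j \<in> carrier G" "y j \<in> carrier G" "lin I d x \<in> carrier G" "lin I d y \<in> carrier G"
      using xy \<open>j \<in> I\<close> by (auto simp: PiE_iff)
    moreover have "x j \<otimes> lin I d x = y j \<otimes> lin I d y" using xy(3) by (metis \<sigma>_def fun_upd_same)
    ultimately have "x j = y j" using l by simp
    moreover have "x i = y i" if "i \<noteq> j" for i using xy(3) that by (metis \<sigma>_def fun_upd_other)
    ultimately show "x = y" by (metis ext)
  qed
  have surj: "\<sigma> ` ?P = ?P"
    using I fin P\<sigma> inj by (intro endo_inj_surj) (auto intro: finite_PiE)
  have q: "quadratic I a c (\<sigma> x) = quadratic I ?a (shear j d c) x" if "x \<in> ?P" for x
    unfolding \<sigma>_def using that I \<open>j \<in> I\<close> antisymmetric_diag[OF \<open>antisymmetric c\<close>]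
    by (intro quadratic_shear) (auto simp: PiE_def)
  obtain y where y: "y \<in> ?P" "z = \<sigma> y" using surj \<open>z \<in> ?P\<close> by blast
  have "{x \<in> ?P. quadratic I a c x = quadratic I a c z}
      = \<sigma> ` {x \<in> ?P. quadratic I ?a (shear j d c) x = quadratic I ?a (shear j d c) y}" (is "_ = _ ` ?N")
  proof (intro equalityI subsetI)
    fix x assume x: "x \<in> {x \<in> ?P. quadratic I a c x = quadratic I a c z}"
    then obtain x' where "x' \<in> ?P" "x = \<sigma> x'" using surj by blast
    then show "x \<in> \<sigma> ` ?N" using x q y by auto
  qed (use q y P\<sigma> in auto)
  moreover have "card (\<sigma> ` ?N) = card ?N" by (rule card_image[OF inj_on_subset[OF inj]]) auto
  ultimately show ?case using shear.IH[OF y(1), of ?a] by simp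
qed

section \<open>Multiplication of a quadratic map by a letter\<close>

lemma beta_bil_right:
  assumes x: "x \<in> I \<rightarrow> carrier G" and u: "u \<in> carrier G"
    and rad: "\<And>x y z. x \<in> carrier G \<Longrightarrow> y \<in> carrier G \<Longrightarrow> z \<in> carrier G \<Longrightarrow> \<beta> x (\<beta> y z) = \<one>"
  shows "\<beta> u (bil I c x x) = \<one>"
proof -
  have "\<beta> u (\<Otimes>i\<in>J. \<beta> (x i) (lin I (c i) x)) = \<one>" if "J \<subseteq> I" for J
    using that
  proof (induction J rule: infinite_finite_induct)
    case (insert j J)
    then have "x j \<in> carrier G" "(\<lambda>i. \<beta> (x i) (lin I (c i) x)) \<in> J \<rightarrow> carrier G" using x by (auto simp: Pi_iff)
    then show ?case using insert x u rad by (simp add: beta_mult_right)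
  qed (use u in auto)
  then show ?thesis by (simp add: bil_def)
qed

text \<open>
  Writing \<open>2 \<beta>(u, v)\<close> as \<open>\<beta>(u, v) - \<beta>(v, u)\<close> is what keeps the matrix \<open>c'\<close> antisymmetric.
\<close>

lemma quadratic_letter:
  fixes I :: "'i set" and c :: "'i \<Rightarrow> 'i \<Rightarrow> int"
  defines "c' \<equiv> (\<lambda>m e a i j. c i j + ((if i = m then e else 0) * a j + (if j = m then - e * a i else 0)))"
  assumes I: "finite I" "m \<in> I" and x: "x \<in> I \<rightarrow> carrier G"
    and alt: "\<And>x y. x \<in> carrier G \<Longrightarrow> y \<in> carrier G \<Longrightarrow> \<beta> y x = inv \<beta> x y"
    and rad: "\<And>x y z. x \<in> carrier G \<Longrightarrow> y \<in> carrier G \<Longrightarrow> z \<in> carrier G \<Longrightarrow> \<beta> x (\<beta> y z) = \<one>"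
  shows "x m [^] e \<otimes> quadratic I a c x
      \<otimes> (\<beta> (x m [^] e) (quadratic I a c x) \<otimes> \<beta> (x m [^] e) (quadratic I a c x))
    = quadratic I (\<lambda>i. a i + (if i = m then e else 0)) (c' m e a) x"
proof -
  define B where "B = \<beta> (x m) (lin I a x) [^] e"
  have xi: "\<And>i. i \<in> I \<Longrightarrow> x i \<in> carrier G" using x by auto
  have xm: "x m \<in> carrier G" by (rule xi[OF I(2)])
  have B: "B \<in> carrier G" using xm x by (simp add: B_def)
  \<comment> \<open>Values of \<open>\<beta>\<close> lie in its radical, so only the linear part of
    the quadratic map contributes.\<close>
  have "\<beta> (x m [^] e) (quadratic I a c x) = B"
    using xm x by (simp add: quadratic_def B_def beta_mult_right beta_bil_right rad beta_int_pow)
  moreover have "bil I (c' m e a) x x = bil I c x x \<otimes> (B \<otimes> B)"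
  proof -
    have "bil I (c' m e a) x x = (\<Otimes>i\<in>I. \<beta> (x i) (lin I (c i) x) \<otimes>
        ((if i = m then \<beta> (x i) (lin I a x) [^] e else \<one>) \<otimes> \<beta> (x i) (x m) [^] (- e * a i)))"
      unfolding bil_def
    proof (rule finprod_cong'[OF refl], goal_cases)
      case 1
      show ?case using xi x xm by (simp add: Pi_iff)
    next
      case (2 i)
      have "lin I (c' m e a i) x = lin I (c i) x \<otimes> (lin I a x [^] (if i = m then e else 0) \<otimes> x m [^] (- e * a i))"
        unfolding c'_def using x xm I by (simp add: lin_add lin_scale lin_single)
      then show ?case
        using xi[of i] 2 x xm by (auto simp: beta_mult_right beta_int_pow)
    qed
    also have "\<dots> = bil I c x x \<otimes> ((\<Otimes>i\<in>I. if i = m then \<beta> (x i) (lin I a x) [^] e else \<one>)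
        \<otimes> (\<Otimes>i\<in>I. \<beta> (x i) (x m) [^] (- e * a i)))"
      unfolding bil_def using xi x xm by (subst finprod_multf, simp_all add: Pi_iff)
    also have "(\<Otimes>i\<in>I. if i = m then \<beta> (x i) (lin I a x) [^] e else \<one>) = B"
      unfolding B_def using xi x I by (intro finprod_singleton_swap) auto
    \<comment> \<open>Column \<open>m\<close> gives -e \<beta>(\<Sum> a_i x_i, x_m), which
      alternation turns into the second copy of \<open>B\<close>.\<close>
    also have "(\<Otimes>i\<in>I. \<beta> (x i) (x m) [^] (- e * a i)) = \<beta> (lin I (\<lambda>i. - e * a i) x) (x m)"
      using x xm by (simp add: beta_lin_left)
    also have "\<dots> = B"
      using x xm alt[of "x m" "lin I a x"] unfolding lin_scale[OF x]
      by (simp add: beta_int_pow B_def) (simp add: int_pow_neg int_pow_inv)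
    finally show ?thesis .
  qed
  ultimately show ?thesis
    using x xm B I by (simp add: quadratic_def lin_add lin_single m_ac)
qed

end


section \<open>The Baer correspondence\<close>

text \<open>The class condition takes the form in which it is used: commutators are central.\<close>

locale odd_class_two_group = group G for G :: "('a, 'b) monoid_scheme" (structure) +
  assumes finite_carrier: "finite (carrier G)" and odd_order: "odd (order G)"
    and commutator_central: "\<lbrakk>x \<in> carrier G; y \<in> carrier G; z \<in> carrier G\<rbrakk> \<Longrightarrow>
      (inv x \<otimes> inv y \<otimes> x \<otimes> y) \<otimes> z = z \<otimes> (inv x \<otimes> inv y \<otimes> x \<otimes> y)"
begin

section \<open>Commutators and the pairing\<close>

definition comm :: "'a \<Rightarrow> 'a \<Rightarrow> 'a"
  where "comm x y = inv x \<otimes> inv y \<otimes> x \<otimes> y"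

lemma comm_closed [simp]: "x \<in> carrier G \<Longrightarrow> y \<in> carrier G \<Longrightarrow> comm x y \<in> carrier G"
  by (simp add: comm_def)

lemma comm_central: "x \<in> carrier G \<Longrightarrow> y \<in> carrier G \<Longrightarrow> z \<in> carrier G \<Longrightarrow> comm x y \<otimes> z = z \<otimes> comm x y"
  unfolding comm_def by (rule commutator_central)

lemma mult_comm: "x \<in> carrier G \<Longrightarrow> y \<in> carrier G \<Longrightarrow> x \<otimes> y = y \<otimes> x \<otimes> comm x y"
  by (simp add: comm_def m_assoc inv_solve_left' flip: m_assoc[of x "inv x"] m_assoc[of y "inv y"])

lemma comm_eqI:
  assumes "x \<in> carrier G" "y \<in> carrier G" "z \<in> carrier G" "x \<otimes> y = y \<otimes> x \<otimes> z"
  shows "comm x y = z"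
  using assms mult_comm[OF assms(1,2)] by (metis comm_closed l_cancel m_closed)

text \<open>Moving \<open>z\<close> to the left past \<open>y\<close> and then past \<open>x\<close>
  creates one commutator each time, and centrality lets them be collected on the right.\<close>

lemma comm_mult_left:
  assumes "x \<in> carrier G" "y \<in> carrier G" "z \<in> carrier G"
  shows "comm (x \<otimes> y) z = comm x z \<otimes> comm y z"
proof (rule comm_eqI)
  have "x \<otimes> y \<otimes> z = x \<otimes> (z \<otimes> y \<otimes> comm y z)"
    using assms mult_comm[of y z] by (simp add: m_assoc)
  also have "\<dots> = (x \<otimes> z) \<otimes> y \<otimes> comm y z" using assms by (simp add: m_assoc)
  also have "x \<otimes> z = z \<otimes> x \<otimes> comm x z" using assms by (intro mult_comm)
  also have "\<dots> \<otimes> y = z \<otimes> x \<otimes> (comm x z \<otimes> y)" using assms by (simp add: m_assoc)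
  also have "comm x z \<otimes> y = y \<otimes> comm x z" using assms by (intro comm_central)
  finally show "x \<otimes> y \<otimes> z = z \<otimes> (x \<otimes> y) \<otimes> (comm x z \<otimes> comm y z)" using assms by (simp add: m_assoc)
qed (use assms in auto)

lemma comm_inverse:
  assumes "x \<in> carrier G" "y \<in> carrier G"
  shows "comm y x = inv (comm x y)"
  using assms by (simp add: comm_def inv_mult_group m_assoc)

text \<open>(|G| + 1)/2 inverts 2 modulo the odd number |G|, so this is [x, y]^(1/4). The quarter
  makes the Baer term [x, y]^(1/2) equal to 2 \<beta>(x, y) = \<beta>(x, y) - \<beta>(y, x),
  antisymmetric with integer coefficients.\<close>

definition \<beta> :: "'a \<Rightarrow> 'a \<Rightarrow> 'a"
  where "\<beta> x y = comm x y [^] ((order G + 1) div 2)\<^sup>2"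

lemma beta_closed [simp]: "x \<in> carrier G \<Longrightarrow> y \<in> carrier G \<Longrightarrow> \<beta> x y \<in> carrier G"
  by (simp add: \<beta>_def)

lemma beta_central:
  assumes "x \<in> carrier G" "y \<in> carrier G" "z \<in> carrier G"
  shows "\<beta> x y \<otimes> z = z \<otimes> \<beta> x y"
proof -
  have "comm x y [^] n \<otimes> z = z \<otimes> comm x y [^] n" for n :: nat
  proof (induction n)
    case (Suc n)
    have "comm x y [^] Suc n \<otimes> z = comm x y [^] n \<otimes> (comm x y \<otimes> z)" using assms by (simp add: m_assoc)
    also have "\<dots> = (comm x y [^] n \<otimes> z) \<otimes> comm x y" using assms by (simp add: comm_central m_assoc)
    also have "\<dots> = z \<otimes> comm x y [^] Suc n" using assms unfolding Suc by (simp add: m_assoc)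
    finally show ?case .
  qed (use assms in simp)
  then show ?thesis by (simp add: \<beta>_def)
qed

lemma beta_mult_left:
  assumes "x \<in> carrier G" "y \<in> carrier G" "z \<in> carrier G"
  shows "\<beta> (x \<otimes> y) z = \<beta> x z \<otimes> \<beta> y z"
  unfolding \<beta>_def comm_mult_left[OF assms] using assms by (intro pow_mult_distrib comm_central) auto

lemma beta_inverse: "x \<in> carrier G \<Longrightarrow> y \<in> carrier G \<Longrightarrow> \<beta> y x = inv (\<beta> x y)"
  unfolding \<beta>_def by (simp add: comm_inverse[of x y] nat_pow_inv)

lemma beta_cancel [simp]: "x \<in> carrier G \<Longrightarrow> y \<in> carrier G \<Longrightarrow> \<beta> x y \<otimes> \<beta> y x = \<one>"
  by (simp add: beta_inverse[of x y])

lemma beta_mult_right: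
  assumes "x \<in> carrier G" "y \<in> carrier G" "z \<in> carrier G"
  shows "\<beta> x (y \<otimes> z) = \<beta> x y \<otimes> \<beta> x z"
  using assms beta_inverse[of "y \<otimes> z" x] beta_inverse[of y x] beta_inverse[of z x]
    beta_central[of x y "\<beta> x z"]
  by (simp add: beta_mult_left inv_mult_group)

lemma beta_central_right:
  assumes "x \<in> carrier G" "z \<in> carrier G" "\<And>y. y \<in> carrier G \<Longrightarrow> z \<otimes> y = y \<otimes> z"
  shows "\<beta> x z = \<one>"
proof -
  have "comm x z = \<one>" using assms by (intro comm_eqI) auto
  then show ?thesis by (simp add: \<beta>_def)
qed

lemma beta_beta [simp]:
  assumes "x \<in> carrier G" "y \<in> carrier G" "z \<in> carrier G"
  shows "\<beta> x (\<beta> y z) = \<one>" "\<beta> (\<beta> y z) x = \<one>"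
proof -
  show "\<beta> x (\<beta> y z) = \<one>" using assms by (intro beta_central_right beta_central) auto
  then show "\<beta> (\<beta> y z) x = \<one>" using assms beta_inverse[of x "\<beta> y z"] by simp
qed

lemma beta_self [simp]: "x \<in> carrier G \<Longrightarrow> \<beta> x x = \<one>"
  by (simp add: \<beta>_def comm_def m_assoc)

lemma comm_eq_beta:
  assumes "x \<in> carrier G" "y \<in> carrier G"
  shows "comm x y = \<beta> x y \<otimes> \<beta> x y \<otimes> (\<beta> x y \<otimes> \<beta> x y)"
proof -
  obtain n where n: "order G = 2 * n + 1" using odd_order by (auto elim: oddE)
  \<comment> \<open>Four times the exponent is (|G| + 1)^2, which is 1 modulo |G|.\<close>
  have "((order G + 1) div 2)\<^sup>2 + ((order G + 1) div 2)\<^sup>2 + (((order G + 1) div 2)\<^sup>2 + ((order G + 1) div 2)\<^sup>2)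
      = order G * (order G + 2) + 1"
    by (simp add: n power2_eq_square algebra_simps)
  then have "\<beta> x y \<otimes> \<beta> x y \<otimes> (\<beta> x y \<otimes> \<beta> x y) = comm x y [^] (order G * (order G + 2) + 1)"
    unfolding \<beta>_def using assms by (simp add: nat_pow_mult)
  also have "\<dots> = (comm x y [^] order G) [^] (order G + 2) \<otimes> comm x y"
    unfolding nat_pow_pow[OF comm_closed[OF assms]] by simp
  finally show ?thesis using assms pow_order_eq_1[of "comm x y"] by simp
qed

text \<open>
  The additive group of the Lie ring that the Baer correspondence attaches to \<open>G\<close>: with
  \<open>\<beta>(x, y) = [x, y]\<^sup>1\<^sup>/\<^sup>4\<close>, the product below is \<open>x y [x, y]\<^sup>-\<^sup>1\<^sup>/\<^sup>2\<close>.
\<close>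

definition baer :: "'a monoid"
  where "baer = \<lparr>carrier = carrier G, monoid.mult = (\<lambda>x y. x \<otimes> y \<otimes> (\<beta> y x \<otimes> \<beta> y x)), one = \<one>\<rparr>"

lemma carrier_baer [simp]: "carrier baer = carrier G"
  and one_baer [simp]: "\<one>\<^bsub>baer\<^esub> = \<one>"
  and mult_baer: "x \<otimes>\<^bsub>baer\<^esub> y = x \<otimes> y \<otimes> (\<beta> y x \<otimes> \<beta> y x)"
  by (simp_all add: baer_def)

lemma beta_inv_self [simp]: "x \<in> carrier G \<Longrightarrow> \<beta> x (inv x) = \<one>"
  using beta_mult_right[of x x "inv x"] beta_central_right[of x \<one>] by simp

lemma beta_mult_baer_left:
  assumes "x \<in> carrier G" "y \<in> carrier G" "z \<in> carrier G"
  shows "\<beta> (x \<otimes>\<^bsub>baer\<^esub> y) z = \<beta> x z \<otimes> \<beta> y z"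
  using assms by (simp add: mult_baer beta_mult_left)

lemma beta_mult_baer_right:
  assumes "x \<in> carrier G" "y \<in> carrier G" "z \<in> carrier G"
  shows "\<beta> z (x \<otimes>\<^bsub>baer\<^esub> y) = \<beta> z x \<otimes> \<beta> z y"
  using assms by (simp add: mult_baer beta_mult_right)

text \<open>Swapping the factors costs [x, y], which is four copies of \<open>\<beta> x y\<close>;
  two of them cancel the correction \<open>\<beta> y x\<close> and the other two are the correction
  for the swapped product.\<close>

lemma mult_baer_commute:
  assumes "x \<in> carrier G" "y \<in> carrier G"
  shows "x \<otimes>\<^bsub>baer\<^esub> y = y \<otimes>\<^bsub>baer\<^esub> x"
proof -
  have "x \<otimes>\<^bsub>baer\<^esub> y = y \<otimes> x \<otimes> (\<beta> x y \<otimes> \<beta> x y \<otimes> (\<beta> x y \<otimes> \<beta> x y)) \<otimes> (\<beta> y x \<otimes> \<beta> y x)"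
    using assms mult_comm[of x y] comm_eq_beta[of x y] by (simp add: mult_baer)
  also have "\<dots> = y \<otimes> x \<otimes> (\<beta> x y \<otimes> \<beta> x y \<otimes> (\<beta> x y \<otimes> (\<beta> x y \<otimes> \<beta> y x) \<otimes> \<beta> y x))"
    using assms by (simp add: m_assoc del: beta_cancel)
  also have "\<dots> = y \<otimes>\<^bsub>baer\<^esub> x" using assms by (simp add: mult_baer)
  finally show ?thesis .
qed

text \<open>Both sides are \<open>x \<otimes> y \<otimes> z\<close> times the squares of the central
  elements \<open>a\<close>, \<open>b\<close>, \<open>c\<close>, since \<open>\<beta>\<close> is
  additive for the Baer product.\<close>

lemma mult_baer_assoc:
  assumes "x \<in> carrier G" "y \<in> carrier G" "z \<in> carrier G"
  shows "x \<otimes>\<^bsub>baer\<^esub> y \<otimes>\<^bsub>baer\<^esub> z = x \<otimes>\<^bsub>baer\<^esub> (y \<otimes>\<^bsub>baer\<^esub> z)"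
proof -
  define a b c where "a = \<beta> y x" and "b = \<beta> z x" and "c = \<beta> z y"
  have car: "a \<in> carrier G" "b \<in> carrier G" "c \<in> carrier G" using assms by (simp_all add: a_def b_def c_def)
  have cen: "a \<otimes> u = u \<otimes> a" "b \<otimes> u = u \<otimes> b" "c \<otimes> u = u \<otimes> c" if "u \<in> carrier G" for u
    using assms that by (simp_all add: a_def b_def c_def beta_central)
  have "x \<otimes>\<^bsub>baer\<^esub> y \<otimes>\<^bsub>baer\<^esub> z = x \<otimes>\<^bsub>baer\<^esub> y \<otimes> z \<otimes> (b \<otimes> c \<otimes> (b \<otimes> c))"
    unfolding mult_baer[of "x \<otimes>\<^bsub>baer\<^esub> y" z] using assms by (simp add: beta_mult_baer_right b_def c_def)
  also have "\<dots> = x \<otimes> y \<otimes> (a \<otimes> a \<otimes> (z \<otimes> (b \<otimes> c \<otimes> (b \<otimes> c))))"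
    using assms car by (simp add: mult_baer a_def[symmetric] m_assoc)
  also have "a \<otimes> a \<otimes> (z \<otimes> (b \<otimes> c \<otimes> (b \<otimes> c))) = z \<otimes> (c \<otimes> c \<otimes> (a \<otimes> b \<otimes> (a \<otimes> b)))"
  proof -
    have pull: "a \<otimes> (v \<otimes> u) = v \<otimes> (a \<otimes> u)" "b \<otimes> (v \<otimes> u) = v \<otimes> (b \<otimes> u)" "c \<otimes> (v \<otimes> u) = v \<otimes> (c \<otimes> u)"
      if "u \<in> carrier G" "v \<in> carrier G" for u v
      using that car cen[of v] by (simp_all flip: m_assoc)
    \<comment> \<open>Rewriting rules that bring \<open>z\<close> to the front and order the central
      factors as \<open>a\<close>, \<open>b\<close>, \<open>c\<close>.\<close>
    note sort = pull(1)[OF _ assms(3)] pull(2)[OF _ car(1)] pull(3)[OF _ car(1)] pull(3)[OF _ car(2)]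
      cen(2)[OF car(1)] cen(3)[OF car(1)] cen(3)[OF car(2)]
    show ?thesis using car assms by (simp add: m_assoc sort)
  qed
  also have "x \<otimes> y \<otimes> (z \<otimes> (c \<otimes> c \<otimes> (a \<otimes> b \<otimes> (a \<otimes> b)))) = x \<otimes> (y \<otimes>\<^bsub>baer\<^esub> z) \<otimes> (a \<otimes> b \<otimes> (a \<otimes> b))"
    using assms car by (simp add: mult_baer c_def[symmetric] m_assoc)
  also have "\<dots> = x \<otimes>\<^bsub>baer\<^esub> (y \<otimes>\<^bsub>baer\<^esub> z)"
    unfolding mult_baer[of x "y \<otimes>\<^bsub>baer\<^esub> z"] using assms by (simp add: beta_mult_baer_left a_def b_def)
  finally show ?thesis .
qed

lemma inv_mult_baer: "x \<in> carrier G \<Longrightarrow> inv x \<otimes>\<^bsub>baer\<^esub> x = \<one>"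
  by (simp add: mult_baer)

lemma mult_baer_closed: "x \<in> carrier G \<Longrightarrow> y \<in> carrier G \<Longrightarrow> x \<otimes>\<^bsub>baer\<^esub> y \<in> carrier G"
  by (simp add: mult_baer)

lemma comm_group_baer: "comm_group baer"
proof (rule comm_groupI)
  fix x assume "x \<in> carrier baer"
  then show "\<exists>y\<in>carrier baer. y \<otimes>\<^bsub>baer\<^esub> x = \<one>\<^bsub>baer\<^esub>"
    using inv_mult_baer[of x] by (intro bexI[of _ "inv x"]) auto
  show "\<one>\<^bsub>baer\<^esub> \<otimes>\<^bsub>baer\<^esub> x = x"
    using \<open>x \<in> carrier baer\<close> beta_central_right[of x \<one>] by (simp add: mult_baer)
qed (auto simp: mult_baer_closed mult_baer_assoc intro: mult_baer_commute)

text \<open>On values of \<open>\<beta>\<close> the Baer product agrees with the group product,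
  because the correction vanishes there; so bilinearity carries over.\<close>

sublocale baer: bilinear_pairing baer \<beta>
proof (rule bilinear_pairing.intro[OF comm_group_baer])
  show "bilinear_pairing_axioms baer \<beta>"
    by unfold_locales
      (simp_all add: beta_mult_baer_left beta_mult_baer_right mult_baer[of "\<beta> _ _" "\<beta> _ _"])
qed

section \<open>Word maps as quadratic maps over the Baer group\<close>

lemma mult_eq_baer:
  assumes "x \<in> carrier G" "y \<in> carrier G"
  shows "x \<otimes> y = x \<otimes>\<^bsub>baer\<^esub> y \<otimes>\<^bsub>baer\<^esub> (\<beta> x y \<otimes>\<^bsub>baer\<^esub> \<beta> x y)"
proof -
  \<comment> \<open>Adding the product of two values of \<open>\<beta>\<close> is therefore plain
    multiplication, and the two factors \<open>\<beta> x y\<close> cancel the correction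
    \<open>\<beta> y x\<close> in the Baer product.\<close>
  have "\<beta> (\<beta> x y \<otimes> \<beta> x y) z = \<one>" if "z \<in> carrier G" for z using assms that by (simp add: beta_mult_left)
  then have "x \<otimes>\<^bsub>baer\<^esub> y \<otimes>\<^bsub>baer\<^esub> (\<beta> x y \<otimes>\<^bsub>baer\<^esub> \<beta> x y) = x \<otimes> y \<otimes> (\<beta> y x \<otimes> (\<beta> y x \<otimes> \<beta> x y) \<otimes> \<beta> x y)"
    using assms mult_baer_closed[OF assms]
    by (simp add: mult_baer[of "x \<otimes>\<^bsub>baer\<^esub> y"] mult_baer[of "\<beta> x y" "\<beta> x y"] del: beta_cancel)
      (simp add: mult_baer m_assoc del: beta_cancel)
  then show ?thesis using assms by simp
qed

lemma inv_baer: "x \<in> carrier G \<Longrightarrow> inv\<^bsub>baer\<^esub> x = inv x"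
  using baer.inv_equality[of "inv x" x] inv_mult_baer[of x] by simp

text \<open>Induction on the word: prepending a letter is a group product, which
  \<open>mult_eq_baer\<close> expresses in the Baer group and \<open>quadratic_letter\<close>
  absorbs into new coefficients.\<close>

lemma word_value_quadratic:
  assumes "finite I" "fst ` set w \<subseteq> I"
  shows "\<exists>a c. antisymmetric c \<and> (\<forall>x \<in> I \<rightarrow> carrier G. word_value G x w = baer.quadratic I a c x)"
  using assms(2)
proof (induction w)
  case Nil
  have "\<one> = baer.quadratic I (\<lambda>_. 0) (\<lambda>_ _. 0) x" if "x \<in> I \<rightarrow> carrier G" for x
  proof -
    have "baer.lin I (\<lambda>_. 0) x = \<one>"
      using baer.finprod_one_eqI[of I "\<lambda>_. \<one>"] by (simp add: baer.lin_def)
    moreover have "baer.bil I (\<lambda>_ _. 0) x x = \<one>\<^bsub>baer\<^esub>"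
      unfolding baer.bil_def \<open>baer.lin I (\<lambda>_. 0) x = \<one>\<close> using that baer.beta_one(2)
      by (intro baer.finprod_one_eqI) auto
    ultimately show ?thesis using baer.l_one[of \<one>] by (simp add: baer.quadratic_def)
  qed
  moreover have "antisymmetric (\<lambda>_ _. 0 :: int)" by (simp add: antisymmetric_def)
  ultimately show ?case by (metis word_value_Nil)
next
  case (Cons l w)
  then obtain a c where c: "antisymmetric c"
    and w: "\<And>x. x \<in> I \<rightarrow> carrier G \<Longrightarrow> word_value G x w = baer.quadratic I a c x" by auto
  define m where "m = fst l"
  define e :: int where "e = (if snd l then 1 else - 1)"
  have m: "m \<in> I" using Cons.prems by (simp add: m_def)
  \<comment> \<open>Row \<open>m\<close> gains e a_j and column \<open>m\<close> loses e a_i; the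
    two changes are negative transposes of each other.\<close>
  define c' where "c' i j = c i j + ((if i = m then e else 0) * a j + (if j = m then - e * a i else 0))" for i j
  have c'_eq: "c' = (\<lambda>i j. c i j + ((if i = m then e else 0) * a j + (if j = m then - e * a i else 0)))"
    by (intro ext) (simp add: c'_def)
  have "antisymmetric c'"
    unfolding antisymmetric_def
  proof (intro allI)
    fix i j show "c' i j = - c' j i" using antisymmetricD[OF c, of i j] by (auto simp: c'_def)
  qed
  moreover have "word_value G x (l # w) = baer.quadratic I (\<lambda>i. a i + (if i = m then e else 0)) c' x"
    if x: "x \<in> I \<rightarrow> carrier G" for x
  proof -
    have xm: "x m \<in> carrier G" using x m by auto
    \<comment> \<open>The two groups have the same inverses, so the letter is a Baer power with
      exponent 1 or -1.\<close>
    have "letter_value G x l = x m [^]\<^bsub>baer\<^esub> e"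
      using xm baer.int_pow_neg[of "x m" 1] baer.int_pow_1[of "x m"]
      by (simp add: letter_value_def m_def[symmetric] e_def inv_baer)
    then have "word_value G x (l # w) = x m [^]\<^bsub>baer\<^esub> e \<otimes> baer.quadratic I a c x"
      by (simp add: w[OF x])
    also have "\<dots> = baer.quadratic I (\<lambda>i. a i + (if i = m then e else 0)) c' x"
    proof -
      have "x m [^]\<^bsub>baer\<^esub> e \<in> carrier G" "baer.quadratic I a c x \<in> carrier G"
        using baer.int_pow_closed[of "x m" e] baer.quadratic_closed[of x I a c] x xm by simp_all
      then have "x m [^]\<^bsub>baer\<^esub> e \<otimes> baer.quadratic I a c x = x m [^]\<^bsub>baer\<^esub> e \<otimes>\<^bsub>baer\<^esub> baer.quadratic I a c x \<otimes>\<^bsub>baer\<^esub>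
          (\<beta> (x m [^]\<^bsub>baer\<^esub> e) (baer.quadratic I a c x) \<otimes>\<^bsub>baer\<^esub> \<beta> (x m [^]\<^bsub>baer\<^esub> e) (baer.quadratic I a c x))"
        by (rule mult_eq_baer)
      also have "\<dots> = baer.quadratic I (\<lambda>i. a i + (if i = m then e else 0)) c' x"
        unfolding c'_eq
      proof (rule baer.quadratic_letter[OF assms(1) m])
        fix u v assume "u \<in> carrier baer" "v \<in> carrier baer"
        then show "\<beta> v u = inv\<^bsub>baer\<^esub> \<beta> u v" using beta_inverse[of u v] by (simp add: inv_baer)
      qed (use x in auto)
      finally show ?thesis .
    qed
    finally show ?thesis .
  qed
  ultimately show ?case by blast
qed

text \<open>Some tuple \<open>z\<close> solves the equation because \<open>g\<close> is a word
  value, and the solutions form the fibre of the quadratic map through \<open>z\<close>.\<close>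

theorem order_power_le_num_solutions:
  assumes "w \<in> carrier (free_group k)" "g \<in> word_values G k w"
  shows "order G ^ k \<le> (order G)\<^sup>2 * num_solutions G k w g"
proof -
  have "fst ` set w \<subseteq> {1..k}" using assms(1) by (simp add: free_group_def)
  then obtain a c where c: "antisymmetric c"
    and q: "\<And>x. x \<in> {1..k} \<rightarrow> carrier G \<Longrightarrow> word_value G x w = baer.quadratic {1..k} a c x"
    using word_value_quadratic[of "{1..k}" w] by auto
  obtain z where z: "z \<in> (\<Pi>\<^sub>E i\<in>{1..k}. carrier G)" "g = word_value G z w"
    using assms(2) by (auto simp: word_values_def tuples_def)
  have "{x \<in> carrier (tuples G k). word_value G x w = g}
      = {x \<in> (\<Pi>\<^sub>E i\<in>{1..k}. carrier G). baer.quadratic {1..k} a c x = baer.quadratic {1..k} a c z}"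
    using q z by (auto simp: tuples_def PiE_def)
  then show ?thesis
    using baer.card_quadratic_fibre[of "{1..k}" c z a] c z finite_carrier
    by (simp add: num_solutions_def order_def)
qed

end

lemma odd_class_two_groupI:
  fixes G (structure)
  assumes "odd p" "finite_p_group p G" "has_nilpotency_class G 2"
  shows "odd_class_two_group G"
proof -
  interpret group G using assms(2) by (simp add: finite_p_group_def)
  show ?thesis
  proof
    show "finite (carrier G)" "odd (order G)" using assms(1,2) by (auto simp: finite_p_group_def)
    fix x y z assume xyz: "x \<in> carrier G" "y \<in> carrier G" "z \<in> carrier G"
    let ?c = "inv x \<otimes> inv y \<otimes> x \<otimes> y"
    \<comment> \<open>Indexing from 0 makes \<open>lower_central G 1\<close> the derived subgroup,
      so the trivial term \<open>lower_central G 2\<close> contains the commutators of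
      \<open>?c\<close> with group elements.\<close>
    have "?c \<in> lower_central G 1"
      using xyz by (auto simp: commutator_subgroup_def intro!: generate.incl)
    then have "inv ?c \<otimes> inv z \<otimes> ?c \<otimes> z \<in> lower_central G 2"
      using xyz by (force simp: numeral_2_eq_2 commutator_subgroup_def intro!: generate.incl)
    then have "inv ?c \<otimes> inv z \<otimes> ?c \<otimes> z = \<one>"
      using assms(3) by (simp add: has_nilpotency_class_def)
    then have "inv (z \<otimes> ?c) \<otimes> (?c \<otimes> z) = \<one>"
      using xyz by (simp add: inv_mult_group m_assoc)
    moreover have "?c \<in> carrier G" using xyz by simp
    ultimately show "?c \<otimes> z = z \<otimes> ?c"
      using xyz inv_solve_left'[of "\<one>" "z \<otimes> ?c" "?c \<otimes> z"] by simp
  qed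
qed

theorem theoremB:
  fixes G :: "('a, 'b) monoid_scheme" and p k :: nat and w :: "letter list"
  assumes "Factorial_Ring.prime p" and "odd p"
    and "finite_p_group p G"
    and "has_nilpotency_class G 2"
    and "k \<ge> 1"
    and "w \<in> carrier (free_group k)"
  shows "\<forall>g \<in> word_values G k w.
    (of_nat (num_solutions G k w g) :: rat) \<ge> of_nat (order G) powi (int k - 2)"
proof
  fix g assume g: "g \<in> word_values G k w"
  interpret odd_class_two_group G by (rule odd_class_two_groupI[OF assms(2-4)])
  have pos: "(of_nat (order G) :: rat) > 0" using odd_order by (simp add: odd_pos)
  have "(of_nat (order G ^ k) :: rat) \<le> of_nat ((order G)\<^sup>2 * num_solutions G k w g)"
    using order_power_le_num_solutions[OF assms(6) g] by (simp only: of_nat_le_iff)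
  \<comment> \<open>Dividing in the rationals also covers \<open>k = 1\<close>, where the exponent
    is -1.\<close>
  then have "(of_nat (order G) :: rat) ^ k / of_nat (order G) ^ 2 \<le> of_nat (num_solutions G k w g)"
    using pos by (simp add: field_simps)
  then show "of_nat (order G) powi (int k - 2) \<le> (of_nat (num_solutions G k w g) :: rat)"
    using pos by (simp add: power_int_diff)
qed

end
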